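(* Let $n\in\mathbb{N}$ and let $X=(X_1,\dots,X_n):\Omega\to\mathbb{R}^n$ be a random variable with mutually independent components. Then there exists $X'=(X_1',\dots,X_n')\in\mathcal{N}^n$ such that $X'$ has the same distribution as $X$.
   Context: $\mathbb{R}^n$ carries the Borel $\sigma$-algebra. A real random variable is neat if it is a monotonically increasing (nondecreasing) function $(0,1)\to\mathbb{R}$, where $(0,1)$ carries Lebesgue measure on its Borel $\sigma$-algebra; $\mathcal{N}$ is the set of neat random variables. $\mathcal{N}^n$ is the set of product random variables $X':(0,1)^n\to\mathbb{R}^n$, $X'(s_1,\dots,s_n)=(X_1'(s_1),\dots,X_n'(s_n))$, with $X_1',\dots,X_n'\in\mathcal{N}$, where $(0,1)^n$ carries Lebesgue measure. *)

theory Defs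
  imports "HOL-Probability.Probability"
begin

definition unit_interval_space :: "real measure" where
  "unit_interval_space = restrict_space lborel {0<..<1}"

definition unit_cube :: "(real ^ 'n) set" where
  "unit_cube = {s. \<forall>i. s $ i \<in> {0<..<1}}"

definition unit_cube_space :: "(real ^ 'n) measure" where
  "unit_cube_space = restrict_space lborel unit_cube"

(* Functions on (0,1) and (0,1)^n are represented by total functions; their values
   outside these sets are arbitrary and irrelevant. *)

definition neat :: "(real \<Rightarrow> real) set" where
  "neat = {f \<in> borel_measurable unit_interval_space. mono_on {0<..<1} f}"

definition neat_product :: "(real ^ 'n \<Rightarrow> real ^ 'n) set" where
  "neat_product = {X \<in> borel_measurable unit_cube_space.
     \<exists>Y. (\<forall>i. Y i \<in> neat) \<and> (\<forall>s \<in> unit_cube. X s = (\<chi> i. Y i (s $ i)))}"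

end

(* Each X_i is reproduced by its quantile function Y_i on (0,1), which satisfies
   Y_i t <= a iff t <= F_i a, where F_i is the cdf of X_i. So X' = (Y_1, ..., Y_n) pulls
   the orthant below a back to a box, up to null sets, with side lengths F_i (a_i). By
   independence its volume is P(X <= a), and orthants determine Borel measures. *)

theory Submission
  imports Defs
begin

text \<open>The set lies between the open and the closed box with corners \<open>0\<close> and
  \<open>c\<close>, which have equal volume. It need not be a half-open box: where
  \<open>c $ i = 1\<close>, the cube omits the face \<open>s $ i = 1\<close>.\<close>

lemma emeasure_lborel_product_le:
  fixes c :: "real ^ 'n"
  assumes c: "\<And>i. 0 \<le> c $ i" "\<And>i. c $ i \<le> 1"
  shows "emeasure lborel {s \<in> unit_cube. \<forall>i. s $ i \<le> c $ i} = ennreal (\<Prod>i\<in>UNIV. c $ i)"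
    (is "emeasure lborel ?S = _")
proof -
  have meas: "?S \<in> sets lborel"
    unfolding unit_cube_def by measurable
  \<comment> \<open>The product formula for the content is stated for nonempty boxes; sides of
    length 0 are allowed.\<close>
  have le: "cbox 0 c \<noteq> {}"
    using c by (auto simp: interval_eq_empty_cart not_less)
  have cbox: "emeasure lborel (cbox 0 c) = ennreal (\<Prod>i\<in>UNIV. c $ i)"
    using content_cbox_cart[OF le] emeasure_lborel_cbox_finite[of 0 c]
    by (simp add: emeasure_eq_ennreal_measure)
  have box: "emeasure lborel (box 0 c) = emeasure lborel (cbox 0 c)"
    by (simp add: emeasure_lborel_cbox_eq emeasure_lborel_box_eq)
  \<comment> \<open>The bound \<open>c $ i \<le> 1\<close> keeps the open box inside the
    cube.\<close>
  have sub: "box 0 c \<subseteq> ?S" "?S \<subseteq> cbox 0 c"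
    by (auto simp: mem_box_cart unit_cube_def less_imp_le) (meson c(2) less_le_trans)
  show ?thesis
    using emeasure_mono[OF sub(1) meas] emeasure_mono[OF sub(2), of lborel]
    unfolding box cbox by (simp add: antisym)
qed

text \<open>The infimum is the pseudoinverse of the cdf, as in Skorohod's theorem; the locale
  \<open>cdf_distribution\<close> provides its monotonicity and measurability on (0,1).\<close>

lemma quantile_neat:
  assumes "cdf_distribution N"
  shows "(\<lambda>t. Inf {x. t \<le> cdf N x}) \<in> neat"
proof -
  interpret cdf_distribution N by fact
  show ?thesis
    using mono_I measurable_CI
    by (simp add: neat_def unit_interval_space_def cong: measurable_cong_sets sets_restrict_space_cong)
qed

lemma space_unit_cube_space [simp]: "space unit_cube_space = unit_cube"
  by (simp add: unit_cube_space_def space_restrict_space)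

lemma sets_unit_cube [measurable]: "unit_cube \<in> sets borel"
  unfolding unit_cube_def by measurable

text \<open>Measurability can be checked coordinatewise, and each projection maps the cube
  measurably into (0,1).\<close>

lemma neat_product_cart:
  fixes Y :: "'n::finite \<Rightarrow> real \<Rightarrow> real"
  assumes Y: "\<And>i. Y i \<in> neat"
  shows "(\<lambda>s. \<chi> i. Y i (s $ i)) \<in> neat_product"
proof -
  have "(\<lambda>s. Y i (s $ i)) \<in> borel_measurable unit_cube_space" for i
  proof (rule measurable_compose[where g = "Y i"])
    show "(\<lambda>s::real^'n. s $ i) \<in> unit_cube_space \<rightarrow>\<^sub>M unit_interval_space"
      unfolding unit_cube_space_def unit_interval_space_def
      by (intro measurable_restrict_space3) (auto simp: unit_cube_def)
    show "Y i \<in> borel_measurable unit_interval_space"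
      using Y by (simp add: neat_def)
  qed
  then have "(\<lambda>s. \<chi> i. Y i (s $ i)) \<in> borel_measurable unit_cube_space"
    by (subst borel_measurable_euclidean_space) (auto simp: Basis_vec_def inner_axis)
  then show ?thesis
    using Y unfolding neat_product_def by blast
qed

text \<open>Lower orthants form a pi-system, since corners combine by \<open>inf\<close>; they
  generate the Borel sets, and countably many of them cover the space.\<close>

lemma measure_eqI_atMost:
  fixes P Q :: "'a::ordered_euclidean_space measure"
  assumes sets: "sets P = sets borel" "sets Q = sets borel" and fin: "finite_measure P"
    and eq: "\<And>a. emeasure P {..a} = emeasure Q {..a}"
  shows "P = Q"
proof (rule measure_eqI_generator_eq)
  interpret finite_measure P by fact
  show "Int_stable (range (atMost :: 'a \<Rightarrow> _))"
  proof -
    have "{..a} \<inter> {..b} = {..inf a b}" for a b :: 'a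
      by auto
    then show ?thesis
      by (auto simp: Int_stable_def)
  qed
  show "emeasure P (atMost (real k *\<^sub>R One)) \<noteq> \<infinity>" for k
    by simp
  show "(\<Union>k. {..real k *\<^sub>R (One::'a)}) = UNIV"
  proof safe
    fix x :: 'a
    obtain k :: nat where "norm x \<le> real k"
      using real_arch_simple by blast
    \<comment> \<open>No coordinate of \<open>x\<close> exceeds its norm.\<close>
    then have "x \<le> real k *\<^sub>R One"
      using Basis_le_norm[of _ x] by (subst eucl_le) force
    then show "x \<in> (\<Union>k. {..real k *\<^sub>R (One::'a)})"
      by auto
  qed auto
qed (use sets eq in \<open>auto simp: borel_eq_atMost\<close>)

theorem corollary1:
  fixes M :: "'a measure" and X :: "'a \<Rightarrow> real ^ 'n"
  assumes "prob_space M"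
    and "X \<in> borel_measurable M"
    and "prob_space.indep_vars M (\<lambda>_. borel) (\<lambda>i \<omega>. X \<omega> $ i) UNIV"
  shows "\<exists>X' \<in> (neat_product :: (real ^ 'n \<Rightarrow> real ^ 'n) set).
           distr unit_cube_space borel X' = distr M borel X"
proof -
  interpret prob_space M by fact
  note [measurable] = assms(2)
  have Xi [measurable]: "(\<lambda>\<omega>. X \<omega> $ i) \<in> borel_measurable M" for i
    using assms(3) by (simp add: indep_vars_def)
  define N where "N i = distr M borel (\<lambda>\<omega>. X \<omega> $ i)" for i
  have N: "cdf_distribution (N i)" for i
    unfolding cdf_distribution_def N_def by (intro real_distribution_distr Xi)
  have cdf_N: "cdf (N i) a = prob {\<omega> \<in> space M. X \<omega> $ i \<le> a}" for i a
    by (auto simp: cdf_def N_def measure_distr intro!: arg_cong[where f=prob])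
  define Y where "Y i t = Inf {x. t \<le> cdf (N i) x}" for i t
  define X' where "X' s = (\<chi> i. Y i (s $ i))" for s
  have "Y i \<in> neat" for i
    using quantile_neat[OF N] by (simp add: Y_def[abs_def])
  then have X': "X' \<in> neat_product"
    unfolding X'_def[abs_def] by (rule neat_product_cart)
  then have X'_meas: "X' \<in> borel_measurable unit_cube_space"
    by (simp add: neat_product_def)
  \<comment> \<open>The law of \<open>X\<close> stands on the left because finiteness is asked of
    the left measure.\<close>
  have "distr M borel X = distr unit_cube_space borel X'"
  proof (rule measure_eqI_atMost)
    show "finite_measure (distr M borel X)"
      by (intro finite_measure_distr) simp
  next
    fix a :: "real ^ 'n"
    define c :: "real ^ 'n" where "c = (\<chi> i. cdf (N i) (a $ i))"
    have c: "0 \<le> c $ i" "c $ i \<le> 1" for i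
      by (auto simp: c_def cdf_N)
    \<comment> \<open>For \<open>t\<close> strictly between 0 and 1, the limits 0 and 1 of the cdf
      make the set defining \<open>Y i t\<close> nonempty and bounded below, and right continuity
      makes its infimum attained.\<close>
    have Y_le: "Y i t \<le> a $ i \<longleftrightarrow> t \<le> c $ i" if "0 < t" "t < 1" for i t
    proof -
      interpret N: cdf_distribution "N i" by (rule N)
      show ?thesis
        using N.pseudoinverse[OF that, of "a $ i"] by (simp add: Y_def c_def)
    qed
    have "emeasure (distr M borel X) {..a} = prob {\<omega> \<in> space M. \<forall>i. X \<omega> $ i \<le> a $ i}"
      by (simp add: emeasure_distr emeasure_eq_measure less_eq_vec_def vimage_def Int_def conj_commute)
    also have "{\<omega> \<in> space M. \<forall>i. X \<omega> $ i \<le> a $ i} =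
        (\<Inter>i\<in>UNIV. (\<lambda>\<omega>. X \<omega> $ i) -` {..a $ i} \<inter> space M)"
      by auto
    \<comment> \<open>This is where independence enters.\<close>
    also have "prob \<dots> = (\<Prod>i\<in>UNIV. prob ((\<lambda>\<omega>. X \<omega> $ i) -` {..a $ i} \<inter> space M))"
      by (intro indep_varsD[OF assms(3)]) auto
    also have "\<dots> = (\<Prod>i\<in>UNIV. c $ i)"
      by (auto simp: c_def cdf_N intro!: prod.cong arg_cong[where f=prob])
    also have "ennreal \<dots> = emeasure lborel {s \<in> unit_cube. \<forall>i. s $ i \<le> c $ i}"
      by (rule emeasure_lborel_product_le[symmetric]) (fact c)+
    also have "{s \<in> unit_cube. \<forall>i. s $ i \<le> c $ i} = X' -` {..a} \<inter> unit_cube"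
      using Y_le by (auto simp: X'_def less_eq_vec_def unit_cube_def)
    \<comment> \<open>The preimage is a subset of the cube, so restricting \<open>lborel\<close> to
      the cube leaves its measure unchanged.\<close>
    also have "emeasure lborel \<dots> = emeasure (distr unit_cube_space borel X') {..a}"
      using X'_meas
      by (simp add: emeasure_distr) (simp add: unit_cube_space_def emeasure_restrict_space)
    finally show "emeasure (distr M borel X) {..a} = emeasure (distr unit_cube_space borel X') {..a}" .
  qed simp_all
  with X' show ?thesis
    by metis
qed

end
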